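(* Let $R=\mathbb F_{q_1}\times\cdots\times\mathbb F_{q_t}$ be a product of $t$ finite fields. Then $\mathcal D(R)$ is a perfect graph if $t\in\{3,4\}$, and is not perfect if $t\ge 5$.
   Context: $Z(R)$ is the set of zero-divisors of $R$ and $Z(R)^*=Z(R)\setminus\{0\}$. $\Gamma(R)$ is the simple graph with vertex set $Z(R)^*$, with distinct $x,y$ adjacent iff $xy=0$. $W\Gamma(R)$ is the simple graph with vertex set $Z(R)^*$, with distinct $x,y$ adjacent iff there exist nonzero $r\in\operatorname{Ann}(x)$ and nonzero $s\in\operatorname{Ann}(y)$ with $rs=0$. The weak zero-divisor difference graph $\mathcal D(R)$ is the graph on $Z(R)^*$ with edge set $E(W\Gamma(R))\setminus E(\Gamma(R))$, with resulting isolated vertices deleted. A graph $G$ is perfect if $\chi(H)=\omega(H)$ for every induced subgraph $H$ of $G$, where $\chi$ is the chromatic number and $\omega$ the clique number. *)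

theory Defs
  imports "HOL-Algebra.Chinese_Remainder" "HOL-Library.Ramsey"
begin

section \<open>Simple graphs\<close>

text \<open>Edges are unordered pairs, i.e. two-element sets of vertices; the graphs built below
  satisfy this by construction.\<close>

record 'a sgraph =
  verts :: "'a set"
  edges :: "'a set set"

definition graph_of_adj :: "'a set \<Rightarrow> ('a \<Rightarrow> 'a \<Rightarrow> bool) \<Rightarrow> 'a sgraph" where
  "graph_of_adj V adj =
     \<lparr>verts = V, edges = {{x, y} | x y. x \<in> V \<and> y \<in> V \<and> x \<noteq> y \<and> adj x y}\<rparr>"

definition delete_isolated :: "'a sgraph \<Rightarrow> 'a sgraph" where
  "delete_isolated G = \<lparr>verts = {v \<in> verts G. \<exists>e \<in> edges G. v \<in> e}, edges = edges G\<rparr>"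

definition induced_sgraph :: "'a sgraph \<Rightarrow> 'a set \<Rightarrow> 'a sgraph" where
  "induced_sgraph G W = \<lparr>verts = W, edges = {e \<in> edges G. e \<subseteq> W}\<rparr>"

definition proper_colouring :: "'a sgraph \<Rightarrow> nat \<Rightarrow> ('a \<Rightarrow> nat) \<Rightarrow> bool" where
  "proper_colouring G k c \<longleftrightarrow>
     (\<forall>v \<in> verts G. c v < k) \<and>
     (\<forall>v \<in> verts G. \<forall>w \<in> verts G. {v, w} \<in> edges G \<longrightarrow> c v \<noteq> c w)"

text \<open>The two graph invariants below are only meaningful for finite graphs.\<close>

definition chromatic_number :: "'a sgraph \<Rightarrow> nat" where
  "chromatic_number G = (LEAST k. \<exists>c. proper_colouring G k c)"

definition clique_number :: "'a sgraph \<Rightarrow> nat" where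
  "clique_number G = Max {card K | K. K \<subseteq> verts G \<and> clique K (edges G)}"

definition perfect_graph :: "'a sgraph \<Rightarrow> bool" where
  "perfect_graph G \<longleftrightarrow>
     (\<forall>W \<subseteq> verts G.
        chromatic_number (induced_sgraph G W) = clique_number (induced_sgraph G W))"

section \<open>Zero-divisor graphs of a commutative ring\<close>

text \<open>As usual for these graphs, \<open>\<zero>\<close> counts as a zero-divisor (of a nonzero ring).\<close>

definition zero_divisors :: "('a, 'm) ring_scheme \<Rightarrow> 'a set" where
  "zero_divisors R =
     {x \<in> carrier R. \<exists>y \<in> carrier R. y \<noteq> \<zero>\<^bsub>R\<^esub> \<and> x \<otimes>\<^bsub>R\<^esub> y = \<zero>\<^bsub>R\<^esub>}"

definition nonzero_zero_divisors :: "('a, 'm) ring_scheme \<Rightarrow> 'a set" where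
  "nonzero_zero_divisors R = zero_divisors R - {\<zero>\<^bsub>R\<^esub>}"

definition annihilator :: "('a, 'm) ring_scheme \<Rightarrow> 'a \<Rightarrow> 'a set" where
  "annihilator R x = {r \<in> carrier R. r \<otimes>\<^bsub>R\<^esub> x = \<zero>\<^bsub>R\<^esub>}"

definition zero_divisor_graph :: "('a, 'm) ring_scheme \<Rightarrow> 'a sgraph" where
  "zero_divisor_graph R =
     graph_of_adj (nonzero_zero_divisors R) (\<lambda>x y. x \<otimes>\<^bsub>R\<^esub> y = \<zero>\<^bsub>R\<^esub>)"

definition weak_zero_divisor_graph :: "('a, 'm) ring_scheme \<Rightarrow> 'a sgraph" where
  "weak_zero_divisor_graph R =
     graph_of_adj (nonzero_zero_divisors R)
       (\<lambda>x y. \<exists>r \<in> annihilator R x - {\<zero>\<^bsub>R\<^esub>}. \<exists>s \<in> annihilator R y - {\<zero>\<^bsub>R\<^esub>}.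
          r \<otimes>\<^bsub>R\<^esub> s = \<zero>\<^bsub>R\<^esub>)"

definition weak_zero_divisor_difference_graph :: "('a, 'm) ring_scheme \<Rightarrow> 'a sgraph" where
  "weak_zero_divisor_difference_graph R =
     delete_isolated
       \<lparr>verts = nonzero_zero_divisors R,
        edges = edges (weak_zero_divisor_graph R) - edges (zero_divisor_graph R)\<rparr>"

end

theory Submission
  imports Defs
begin

text \<open>
  Two vertices of the difference graph are adjacent iff they are distinct, their supports in
  \<open>{..<t}\<close> meet, and the supports are not one and the same coatom (the complement of a point).

  For \<open>t \<ge> 5\<close> the idempotents supported on \<open>{0,1}, {1,2}, {2,3}, {3,4}, {4,0}\<close> induce a 5-cycle.

  For \<open>t \<le> 4\<close>, vertices with the same coatom as support have the same neighbours and are pairwise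
  nonadjacent, so it suffices to keep one of each. What remains is the intersection graph of a
  multiset of nonempty subsets of a set with at most four points. Call a non-singleton set \<open>A\<close>
  heavy if it has at least the multiplicity of its complement, ties being broken by a base point
  (all \<open>A\<close> whose complement has fewer than two points are heavy). The heavy sets pairwise meet.
  Giving them distinct colours, and each copy of a light set the colour of a copy of its complement,
  properly colours all non-singletons. The sets through a point \<open>i\<close> pairwise meet, so the colours
  used by non-singletons through \<open>i\<close> are distinct and can be extended to the copies of \<open>{i}\<close> by unused
  colours; these extensions do not interact for different \<open>i\<close>. The number of colours is the size of
  the largest of the cliques formed by the heavy sets and by the stars of the points.
\<close>

section \<open>Colourings and cliques\<close>

lemma card_clique_le_colours:
  assumes "proper_colouring G k c" "K \<subseteq> verts G" "clique K (edges G)"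
  shows "card K \<le> k"
proof -
  have "inj_on c K"
    using assms unfolding proper_colouring_def clique_def inj_on_def by blast
  moreover have "c ` K \<subseteq> {..<k}"
    using assms unfolding proper_colouring_def by blast
  ultimately have "card K \<le> card {..<k}"
    by (intro card_inj_on_le) auto
  then show ?thesis by simp
qed

lemma finite_clique_sizes:
  assumes "finite (verts G)"
  shows "finite {card K | K. K \<subseteq> verts G \<and> clique K (edges G)}"
  by (rule finite_subset[of _ "card ` Pow (verts G)"]) (use assms in auto)

text \<open>A clique with as many vertices as the colouring has colours certifies both invariants at
  once: it bounds every colouring from below, and the colouring bounds every clique from
  above.\<close>

lemma chromatic_number_eq_clique_number:
  assumes fin: "finite (verts G)" and col: "proper_colouring G (card K) c"
    and K: "K \<subseteq> verts G" "clique K (edges G)"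
  shows "chromatic_number G = clique_number G"
proof -
  have "chromatic_number G = card K"
    unfolding chromatic_number_def
    using col card_clique_le_colours[OF _ K] by (intro Least_equality) auto
  moreover have "clique_number G = card K"
    unfolding clique_number_def
    using K card_clique_le_colours[OF col]
    by (intro Max_eqI finite_clique_sizes fin) auto
  ultimately show ?thesis by simp
qed

lemma clique_number_attained:
  assumes "finite (verts G)"
  obtains K where "K \<subseteq> verts G" "clique K (edges G)" "card K = clique_number G"
proof -
  let ?S = "{card K | K. K \<subseteq> verts G \<and> clique K (edges G)}"
  have "?S \<noteq> {}" by (auto intro: exI[of _ "{}"])
  then have "clique_number G \<in> ?S"
    unfolding clique_number_def using Max_in[OF finite_clique_sizes[OF assms]] by blast
  then show ?thesis using that by auto
qed

text \<open>\<open>LEAST\<close> is attained once some colouring exists; numbering the vertices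
  gives one. A loop would rule it out, because \<open>proper_colouring\<close> also compares a
  vertex with itself.\<close>

lemma chromatic_number_colouring:
  assumes "finite (verts G)"
    and loopless: "\<And>v. v \<in> verts G \<Longrightarrow> {v} \<notin> edges G"
  obtains c where "proper_colouring G (chromatic_number G) c"
proof -
  obtain h where "bij_betw h (verts G) {0..<card (verts G)}"
    using ex_bij_betw_finite_nat[OF assms(1)] by blast
  then have "proper_colouring G (card (verts G)) h"
    using loopless unfolding proper_colouring_def bij_betw_def inj_on_def
    by (metis atLeastLessThan_iff image_eqI insert_absorb2)
  then have "\<exists>k c. proper_colouring G k c" by blast
  then have "\<exists>c. proper_colouring G (chromatic_number G) c"
    unfolding chromatic_number_def by (rule LeastI_ex)
  then show ?thesis using that by blast
qed

text \<open>A clique of the cycle has at most two vertices, but two colours cannot alternate around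
  an odd cycle.\<close>

lemma five_cycle_not_perfect:
  assumes W: "{a, b, c, d, e} \<subseteq> verts G"
    and cycle: "{a, b} \<in> edges G" "{b, c} \<in> edges G" "{c, d} \<in> edges G"
      "{d, e} \<in> edges G" "{e, a} \<in> edges G"
    and chords: "{a, c} \<notin> edges G" "{b, d} \<notin> edges G" "{c, e} \<notin> edges G"
      "{d, a} \<notin> edges G" "{e, b} \<notin> edges G"
    and loopless: "\<And>v. v \<in> verts G \<Longrightarrow> {v} \<notin> edges G"
  shows "\<not> perfect_graph G"
proof
  define H where "H = induced_sgraph G {a, b, c, d, e}"
  assume "perfect_graph G"
  then have eq: "chromatic_number H = clique_number H"
    using W unfolding perfect_graph_def H_def by blast
  have vertsH: "verts H = {a, b, c, d, e}"
    and edgesH: "edges H = {x \<in> edges G. x \<subseteq> {a, b, c, d, e}}"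
    unfolding H_def induced_sgraph_def by auto
  have fin: "finite (verts H)" using vertsH by simp
  obtain K where K: "K \<subseteq> verts H" "clique K (edges H)" "card K = clique_number H"
    using clique_number_attained[OF fin] by blast
  \<comment> \<open>Identifying \<open>a\<close> with \<open>c\<close> would turn the edge
    \<open>{c, d}\<close> into the missing chord \<open>{d, a}\<close>; the other pairs follow by
    rotation.\<close>
  have distinct: "a \<noteq> c" "b \<noteq> d" "c \<noteq> e" "d \<noteq> a" "e \<noteq> b"
    using cycle chords by (auto simp: insert_commute)
  have "\<not> (a \<in> K \<and> c \<in> K)" "\<not> (b \<in> K \<and> d \<in> K)" "\<not> (c \<in> K \<and> e \<in> K)"
    "\<not> (d \<in> K \<and> a \<in> K)" "\<not> (e \<in> K \<and> b \<in> K)"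
    using K(2) distinct chords unfolding clique_def edgesH by blast+
  then have "K \<subseteq> {a, b} \<or> K \<subseteq> {b, c} \<or> K \<subseteq> {c, d} \<or> K \<subseteq> {d, e} \<or> K \<subseteq> {e, a}"
    using K(1) unfolding vertsH by blast
  moreover have "card K \<le> 2" if "K \<subseteq> {x, y}" for x y
    using card_mono[OF _ that] card_insert_le_m1[of 2 "{y}" x] by simp
  ultimately have "chromatic_number H \<le> 2" using K(3) eq by metis
  moreover obtain f where f: "proper_colouring H (chromatic_number H) f"
    using chromatic_number_colouring[OF fin] loopless W unfolding vertsH edgesH by blast
  ultimately have "f v < 2" if "v \<in> {a, b, c, d, e}" for v
    using that unfolding proper_colouring_def vertsH by (meson less_le_trans)
  then have "f a < 2" "f b < 2" "f c < 2" "f d < 2" "f e < 2" by auto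
  moreover have "f v \<noteq> f w" if "{v, w} \<in> edges G" "v \<in> {a, b, c, d, e}" "w \<in> {a, b, c, d, e}" for v w
    using f that unfolding proper_colouring_def vertsH edgesH by blast
  then have "f a \<noteq> f b" "f b \<noteq> f c" "f c \<noteq> f d" "f d \<noteq> f e" "f e \<noteq> f a"
    using cycle by auto
  ultimately show False by linarith
qed

section \<open>Intersection graphs of subsets of a four-point set\<close>

text \<open>\<open>T\<close> uses up \<open>card T\<close> colours, and at least
  \<open>card S - card T\<close> remain for \<open>S - T\<close>.\<close>

lemma extend_injective_colouring:
  fixes c :: "'v \<Rightarrow> nat"
  assumes "finite S" "T \<subseteq> S" "inj_on c T" "c ` T \<subseteq> {..<k}" "card S \<le> k"
  obtains e where "inj_on e S" "e ` S \<subseteq> {..<k}" "\<And>v. v \<in> T \<Longrightarrow> e v = c v"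
proof -
  have "card (S - T) \<le> card ({..<k} - c ` T)"
    using assms by (simp add: card_Diff_subset finite_subset card_image)
  then obtain g where g: "g ` (S - T) \<subseteq> {..<k} - c ` T" "inj_on g (S - T)"
    using card_le_inj[of "S - T" "{..<k} - c ` T"] assms(1) by auto
  define e where "e v = (if v \<in> T then c v else g v)" for v
  have S: "S = T \<union> (S - T)" using assms(2) by blast
  have image: "e ` T = c ` T" "e ` (S - T) = g ` (S - T)"
    unfolding e_def by (auto intro: image_cong)
  have "inj_on e T" "inj_on e (S - T)"
    using assms(3) g(2) unfolding e_def inj_on_def by simp_all
  then have "inj_on e (T \<union> (S - T))"
    unfolding inj_on_Un using image g(1) by (simp add: Diff_Diff_Int Diff_triv) blast
  then have "inj_on e S" using S by simp
  moreover have "e ` (T \<union> (S - T)) \<subseteq> {..<k}"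
    unfolding image_Un image using g(1) assms(4) by blast
  then have "e ` S \<subseteq> {..<k}" using S by simp
  ultimately show ?thesis using that unfolding e_def by auto
qed

text \<open>Labelling vertices by \<open>f\<close> encodes a multiset of sets. The clique
  \<open>K\<close> and a colouring with \<open>card K\<close> colours together certify that
  chromatic and clique number agree.\<close>

lemma multiset_of_four_subsets_colouring:
  fixes f :: "'v \<Rightarrow> 'i set"
  assumes finW: "finite W" and finI: "finite I" and cardI: "card I \<le> 4"
    and sets: "\<forall>v \<in> W. f v \<subseteq> I \<and> f v \<noteq> {}"
  shows "\<exists>K c. K \<subseteq> W \<and> (\<forall>u\<in>K. \<forall>v\<in>K. f u \<inter> f v \<noteq> {}) \<and> (\<forall>v\<in>W. c v < card K) \<and>
    (\<forall>u\<in>W. \<forall>v\<in>W. f u \<inter> f v \<noteq> {} \<longrightarrow> c u = c v \<longrightarrow> u = v)"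
proof -
  have f: "f v \<subseteq> I \<and> f v \<noteq> {}" if "v \<in> W" for v using sets that by blast
  define fib where "fib A = {v \<in> W. f v = A}" for A
  \<comment> \<open>Exactly one of a subset of \<open>I\<close> and its complement contains
    \<open>p\<close>, which settles ties. If \<open>I\<close> is empty, \<open>p\<close> is
    arbitrary, but then no subset has two points.\<close>
  define p where "p = (SOME p. p \<in> I)"
  define heavy where "heavy A \<longleftrightarrow> card A \<ge> 2 \<and> (card (I - A) < 2 \<or>
    card (fib (I - A)) < card (fib A) \<or> card (fib (I - A)) = card (fib A) \<and> p \<in> A)" for A
  define H where "H = {v \<in> W. heavy (f v)}"
  define U where "U = {v \<in> W. card (f v) \<ge> 2}"
  define star where "star i = {v \<in> W. i \<in> f v}" for i
  have fin_fib: "finite (fib A)" for A unfolding fib_def using finW by simp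
  have fin_star: "finite (star i)" for i unfolding star_def using finW by simp
  have finH: "finite H" unfolding H_def using finW by simp

  \<comment> \<open>The bound four enters here: disjoint sets with at least two points each must be
    complementary pairs, of which the definition makes only one heavy.\<close>
  have heavy_meet: "A \<inter> B \<noteq> {}" if "heavy A" "heavy B" "A \<subseteq> I" "B \<subseteq> I" for A B
  proof
    assume disj: "A \<inter> B = {}"
    have fin: "finite A" "finite B" using that finI finite_subset by auto
    have AB: "card (A \<union> B) = card A + card B" using disj fin by (simp add: card_Un_disjoint)
    have "card (A \<union> B) \<le> card I" using that finI by (intro card_mono) auto
    moreover have "card A \<ge> 2" "card B \<ge> 2" using that unfolding heavy_def by auto
    ultimately have c: "card A = 2" "card B = 2" "card (A \<union> B) = card I"
      using AB cardI by auto
    then have "A \<union> B = I" using that finI by (intro card_subset_eq) auto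
    then have "B = I - A" "A = I - B" using disj by auto
    then show False using that(1,2) disj c unfolding heavy_def by (metis disjoint_iff less_asym less_irrefl)
  qed

  \<comment> \<open>A non-singleton fails to be heavy only if its complement has at least two points
    and at least its multiplicity; in a tie \<open>p \<notin> A\<close> puts \<open>p\<close> into
    the complement.\<close>
  have light: "heavy (I - A) \<and> card (fib A) \<le> card (fib (I - A))"
    if "\<not> heavy A" "card A \<ge> 2" "A \<subseteq> I" for A
  proof -
    have c: "card (I - A) \<ge> 2" using that unfolding heavy_def by auto
    then have "I \<noteq> {}" by auto
    then have "p \<in> I" unfolding p_def by (auto intro: someI)
    moreover have "I - (I - A) = A" using that by auto
    ultimately show ?thesis using that c unfolding heavy_def by auto
  qed
  have "\<exists>h. h ` fib A \<subseteq> fib (I - A) \<and> inj_on h (fib A)"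
    if "\<not> heavy A" "card A \<ge> 2" "A \<subseteq> I" for A
    using light[OF that] card_le_inj fin_fib by blast
  then obtain \<phi> where \<phi>: "\<phi> A ` fib A \<subseteq> fib (I - A)" "inj_on (\<phi> A) (fib A)"
    if "\<not> heavy A" "card A \<ge> 2" "A \<subseteq> I" for A
    by metis
  \<comment> \<open>\<open>g v\<close> is the heavy vertex whose colour \<open>v\<close> takes:
    itself, or a copy of the complement chosen by the injection \<open>\<phi> (f v)\<close>.\<close>
  define g where "g v = (if heavy (f v) then v else \<phi> (f v) v)" for v
  have g_light: "f (g v) = I - f v \<and> g v \<in> H" if "v \<in> U" "\<not> heavy (f v)" for v
  proof -
    have v: "v \<in> W" "card (f v) \<ge> 2" "f v \<subseteq> I" using that f unfolding U_def by auto
    then have "g v \<in> fib (I - f v)"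
      using \<phi>(1)[OF that(2) v(2,3)] that(2) unfolding g_def fib_def by auto
    then show ?thesis using light[OF that(2) v(2,3)] unfolding fib_def H_def by auto
  qed
  have gH: "g v \<in> H" if "v \<in> U" for v
    using g_light[OF that] that unfolding g_def H_def U_def by auto
  have g_inj: "u = v" if uv: "u \<in> U" "v \<in> U" "f u \<inter> f v \<noteq> {}" "g u = g v" for u v
  proof -
    have sub: "f u \<subseteq> I" "f v \<subseteq> I" using uv f unfolding U_def by auto
    \<comment> \<open>Two light vertices with the same image have the same complement, hence the
      same set, and \<open>\<phi>\<close> is injective there. In the mixed cases the sets are
      complementary and cannot meet.\<close>
    consider "heavy (f u)" "heavy (f v)" | "\<not> heavy (f u)" "\<not> heavy (f v)"
      | "heavy (f u)" "\<not> heavy (f v)" | "\<not> heavy (f u)" "heavy (f v)" by blast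
    then show ?thesis
    proof cases
      case 1
      then show ?thesis using uv unfolding g_def by simp
    next
      case 2
      then have "f u = f v" using g_light uv sub by (metis double_diff subset_refl)
      moreover have "inj_on (\<phi> (f u)) (fib (f u))"
        using \<phi>(2) 2 uv sub unfolding U_def by blast
      ultimately show ?thesis
        using uv 2 unfolding g_def inj_on_def fib_def U_def by auto
    next
      case 3
      then have "f u = I - f v" using g_light[of v] uv unfolding g_def by auto
      then show ?thesis using uv by auto
    next
      case 4
      then have "f v = I - f u" using g_light[of u] uv unfolding g_def by auto
      then show ?thesis using uv by auto
    qed
  qed
  obtain h where h: "bij_betw h H {0..<card H}"
    using ex_bij_betw_finite_nat[OF finH] by blast
  define c0 where "c0 v = h (g v)" for v
  have c0_inj: "u = v" if "u \<in> U" "v \<in> U" "f u \<inter> f v \<noteq> {}" "c0 u = c0 v" for u v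
    using that g_inj gH h unfolding c0_def bij_betw_def inj_on_def by blast
  have c0_less: "c0 v < card H" if "v \<in> U" for v
    using gH[OF that] h unfolding c0_def bij_betw_def by auto

  obtain K where K: "K \<subseteq> W" "\<And>u v. u \<in> K \<Longrightarrow> v \<in> K \<Longrightarrow> f u \<inter> f v \<noteq> {}"
    "card H \<le> card K" "\<And>i. i \<in> I \<Longrightarrow> card (star i) \<le> card K"
  proof -
    \<comment> \<open>The palette must number all of \<open>H\<close> and also leave room for every
      star, so the largest of these cliques is taken.\<close>
    define F where "F = insert H (star ` I)"
    have "finite F" "F \<noteq> {}" unfolding F_def using finI by auto
    then have "Max (card ` F) \<in> card ` F" by (intro Max_in) auto
    then obtain K where K: "K \<in> F" "card K = Max (card ` F)" by auto
    then have max: "card L \<le> card K" if "L \<in> F" for L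
      using \<open>finite F\<close> that by simp
    have "L \<subseteq> W \<and> (\<forall>u\<in>L. \<forall>v\<in>L. f u \<inter> f v \<noteq> {})" if "L \<in> F" for L
      using that heavy_meet f unfolding F_def H_def star_def by auto
    then show ?thesis using K(1) max that[of K] unfolding F_def by auto
  qed
  let ?k = "card K"
  have "\<exists>e. inj_on e (star i) \<and> e ` star i \<subseteq> {..<?k} \<and> (\<forall>v \<in> star i \<inter> U. e v = c0 v)"
    if "i \<in> I" for i
  proof -
    \<comment> \<open>Sets in one star share the point \<open>i\<close>, so \<open>c0\<close>
      already separates the non-singletons there.\<close>
    have "inj_on c0 (star i \<inter> U)"
      using c0_inj unfolding inj_on_def star_def by blast
    moreover have "c0 ` (star i \<inter> U) \<subseteq> {..<?k}"
      using c0_less K(3) by fastforce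
    ultimately show ?thesis
      using extend_injective_colouring[OF fin_star[of i] Int_lower1 _ _ K(4)[OF that]] by metis
  qed
  then obtain e where e: "inj_on (e i) (star i)" "e i ` star i \<subseteq> {..<?k}"
    "\<forall>v \<in> star i \<inter> U. e i v = c0 v" if "i \<in> I" for i
    by metis
  \<comment> \<open>A vertex of \<open>W\<close> outside \<open>U\<close> carries a singleton
    \<open>{i}\<close>, and \<open>the_elem\<close> recovers the star whose extension colours
    it.\<close>
  define c where "c v = (if v \<in> U then c0 v else e (the_elem (f v)) v)" for v
  \<comment> \<open>Two meeting sets lie in a common star, so agreement with the injective
    \<open>e i\<close> on each star makes \<open>c\<close> proper.\<close>
  have c_eq: "c v = e i v" if "v \<in> star i" for v i
  proof (cases "v \<in> U")
    case True
    have "i \<in> I" using f that unfolding star_def by blast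
    from e(3)[OF this] show ?thesis using True that unfolding c_def by simp
  next
    case False
    have v: "v \<in> W" "i \<in> f v" using that unfolding star_def by auto
    then have "finite (f v)" "f v \<noteq> {}" "card (f v) < 2"
      using False f[OF v(1)] finite_subset[OF _ finI] unfolding U_def by (auto simp: not_le)
    then have "card (f v) = 1" by (metis One_nat_def card_0_eq less_2_cases)
    then have "f v = {i}" using v(2) by (metis card_1_singletonE singletonD)
    then show ?thesis using False unfolding c_def by simp
  qed
  show ?thesis
  proof (intro exI conjI ballI impI)
    show "K \<subseteq> W" by (rule K)
    show "f u \<inter> f v \<noteq> {}" if "u \<in> K" "v \<in> K" for u v using K(2) that .
    show "c v < ?k" if v: "v \<in> W" for v
    proof -
      obtain i where i: "i \<in> f v" "i \<in> I" using f[OF v] by auto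
      then have "v \<in> star i" using v unfolding star_def by auto
      then show ?thesis using c_eq e(2)[OF i(2)] by auto
    qed
    show "u = v" if uv: "u \<in> W" "v \<in> W" "f u \<inter> f v \<noteq> {}" "c u = c v" for u v
    proof -
      obtain i where i: "i \<in> f u" "i \<in> f v" "i \<in> I" using f[OF uv(1)] uv(3) by auto
      then have "u \<in> star i" "v \<in> star i" using uv unfolding star_def by auto
      then show ?thesis using c_eq e(1)[OF i(3)] uv(4) unfolding inj_on_def by metis
    qed
  qed
qed

text \<open>\<open>P\<close> marks the labels whose vertices are pairwise nonadjacent twins. Within
  an induced subgraph, one representative of each such class suffices: a colouring of the
  representatives pulls back along \<open>rep\<close>.\<close>

lemma perfect_of_supports_in_four:
  fixes f :: "'v \<Rightarrow> 'i set"
  assumes fin: "finite (verts G)" and finI: "finite I" and cardI: "card I \<le> 4"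
    and f: "\<And>v. v \<in> verts G \<Longrightarrow> f v \<subseteq> I \<and> f v \<noteq> {}"
    and edge: "\<And>u v. u \<in> verts G \<Longrightarrow> v \<in> verts G \<Longrightarrow> {u, v} \<in> edges G \<longleftrightarrow>
      u \<noteq> v \<and> f u \<inter> f v \<noteq> {} \<and> \<not> (f u = f v \<and> P (f u))"
  shows "perfect_graph G"
  unfolding perfect_graph_def
proof (intro allI impI)
  fix W assume W: "W \<subseteq> verts G"
  \<comment> \<open>Where \<open>P\<close> holds, the choice depends on \<open>f v\<close> alone, so
    twins receive the same representative, and it lies in \<open>W\<close>.\<close>
  define rep where "rep v = (if P (f v) then SOME u. u \<in> W \<and> f u = f v else v)" for v
  have rep: "rep v \<in> W \<and> f (rep v) = f v" if "v \<in> W" for v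
    using someI[of "\<lambda>u. u \<in> W \<and> f u = f v" v] that unfolding rep_def by auto
  have rep_cong: "rep u = rep v" if "f u = f v" "P (f u)" for u v
    using that unfolding rep_def by simp
  have rep_id: "rep v = v" if "\<not> P (f v)" for v
    using that unfolding rep_def by simp
  have finW: "finite W" using W fin finite_subset by blast
  have fin_rep: "finite (rep ` W)" using finW by simp
  have f_rep: "\<forall>v \<in> rep ` W. f v \<subseteq> I \<and> f v \<noteq> {}"
    using rep f subsetD[OF W] by simp
  from multiset_of_four_subsets_colouring[where f = f, OF fin_rep finI cardI f_rep]
  obtain K c where K: "K \<subseteq> rep ` W"
      "\<forall>u\<in>K. \<forall>v\<in>K. f u \<inter> f v \<noteq> {}"
    and c: "\<forall>v \<in> rep ` W. c v < card K"
      "\<forall>u \<in> rep ` W. \<forall>v \<in> rep ` W. f u \<inter> f v \<noteq> {} \<longrightarrow> c u = c v \<longrightarrow> u = v"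
    by (elim exE conjE) (rule that)
  let ?H = "induced_sgraph G W"
  have H: "verts ?H = W" "\<And>u v. u \<in> W \<Longrightarrow> v \<in> W \<Longrightarrow> {u, v} \<in> edges ?H \<longleftrightarrow> 
      u \<noteq> v \<and> f u \<inter> f v \<noteq> {} \<and> \<not> (f u = f v \<and> P (f u))"
    using edge W unfolding induced_sgraph_def by auto
  have KW: "K \<subseteq> W" using K rep by blast
  show "chromatic_number ?H = clique_number ?H"
  proof (rule chromatic_number_eq_clique_number)
    show "finite (verts ?H)" using H finW by simp
    show "K \<subseteq> verts ?H" using H KW by simp
    show "clique K (edges ?H)"
      unfolding clique_def
    proof (intro ballI impI)
      fix u v assume uv: "u \<in> K" "v \<in> K" "u \<noteq> v"
      then obtain u' v' where u'v': "u' \<in> W" "v' \<in> W" "u = rep u'" "v = rep v'"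
        using K by blast
      \<comment> \<open>Representatives with a common label satisfying \<open>P\<close> coincide, so
        the distinct \<open>u\<close> and \<open>v\<close> escape the exception to
        adjacency.\<close>
      then have "\<not> (f u = f v \<and> P (f u))" using uv rep rep_cong by metis
      then show "{u, v} \<in> edges ?H" using H(2)[of u v] K(2) subsetD[OF KW] uv by simp
    qed
    show "proper_colouring ?H (card K) (\<lambda>v. c (rep v))"
      unfolding proper_colouring_def H(1)
    proof (intro conjI ballI impI notI)
      show "c (rep v) < card K" if "v \<in> W" for v using c that by simp
      fix v w assume vw: "v \<in> W" "w \<in> W" "{v, w} \<in> edges ?H" "c (rep v) = c (rep w)"
      then have ne: "v \<noteq> w" "f v \<inter> f w \<noteq> {}" "\<not> (f v = f w \<and> P (f v))" using H by auto
      \<comment> \<open>Equal representatives force equal labels. As \<open>v\<close> and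
        \<open>w\<close> are adjacent, \<open>P\<close> then fails, so \<open>rep\<close> fixes both
        and they coincide.\<close>
      then have "rep v = rep w" using c(2) rep vw by simp
      moreover from this have "f v = f w" using rep vw by metis
      ultimately show False using ne rep_id by metis
    qed
  qed
qed

section \<open>Supports in a product of fields\<close>

definition support :: "('a, 'm) ring_scheme list \<Rightarrow> 'a list \<Rightarrow> nat set" where
  "support Fs x = {i. i < length Fs \<and> x ! i \<noteq> \<zero>\<^bsub>Fs ! i\<^esub>}"

lemma RDirProd_list_zero_nth:
  "length \<zero>\<^bsub>RDirProd_list Fs\<^esub> = length Fs \<and>
   (\<forall>i < length Fs. \<zero>\<^bsub>RDirProd_list Fs\<^esub> ! i = \<zero>\<^bsub>Fs ! i\<^esub>)"
  by (induct Fs) (auto simp: RDirProd_list_zero' nth_Cons monoid.defs split: nat.split)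

text \<open>Prepending a coordinate is a ring homomorphism from the binary product, where
  multiplication is componentwise.\<close>

lemma RDirProd_list_mult_Cons:
  assumes "a \<in> carrier F" "b \<in> carrier F"
    "xs \<in> carrier (RDirProd_list Fs)" "ys \<in> carrier (RDirProd_list Fs)"
  shows "(a # xs) \<otimes>\<^bsub>RDirProd_list (F # Fs)\<^esub> (b # ys) =
    (a \<otimes>\<^bsub>F\<^esub> b) # (xs \<otimes>\<^bsub>RDirProd_list Fs\<^esub> ys)"
proof -
  have "(a, xs) \<in> carrier (RDirProd F (RDirProd_list Fs))"
    "(b, ys) \<in> carrier (RDirProd F (RDirProd_list Fs))"
    using assms by (auto simp: RDirProd_carrier)
  from ring_hom_mult[OF RDirProd_list_hom1 this] show ?thesis
    by (simp add: RDirProd_def DirProd_def monoid.defs)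
qed

lemma RDirProd_list_mult_nth:
  assumes "x \<in> carrier (RDirProd_list Fs)" "y \<in> carrier (RDirProd_list Fs)"
  shows "length (x \<otimes>\<^bsub>RDirProd_list Fs\<^esub> y) = length Fs \<and>
    (\<forall>i < length Fs. (x \<otimes>\<^bsub>RDirProd_list Fs\<^esub> y) ! i = x ! i \<otimes>\<^bsub>Fs ! i\<^esub> y ! i)"
  using assms
proof (induct Fs arbitrary: x y)
  case Nil
  then show ?case by (simp add: monoid.defs)
next
  case (Cons F Fs)
  then show ?case
    by (auto simp: RDirProd_list_carrier RDirProd_list_mult_Cons nth_Cons split: nat.split)
qed

locale field_list =
  fixes Fs :: "('a, 'm) ring_scheme list"
  assumes field: "\<And>i. i < length Fs \<Longrightarrow> field (Fs ! i)"
begin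

abbreviation "R \<equiv> RDirProd_list Fs"
abbreviation "supp \<equiv> support Fs"
abbreviation "I \<equiv> {..<length Fs}"

lemma supp_subset: "supp x \<subseteq> I"
  unfolding support_def by auto

lemma eq_zero_iff:
  assumes "x \<in> carrier R"
  shows "x = \<zero>\<^bsub>R\<^esub> \<longleftrightarrow> supp x = {}"
  using RDirProd_list_carrier_mem[OF assms] RDirProd_list_zero_nth[of Fs]
  unfolding support_def list_eq_iff_nth_eq by auto

text \<open>Each factor is a domain, so a coordinate of the product vanishes exactly when one of the
  two entries does.\<close>

lemma mult_eq_zero_iff:
  assumes "x \<in> carrier R" "y \<in> carrier R"
  shows "x \<otimes>\<^bsub>R\<^esub> y = \<zero>\<^bsub>R\<^esub> \<longleftrightarrow> supp x \<inter> supp y = {}"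
proof -
  have "x ! i \<otimes>\<^bsub>Fs ! i\<^esub> y ! i = \<zero>\<^bsub>Fs ! i\<^esub> \<longleftrightarrow> x ! i = \<zero>\<^bsub>Fs ! i\<^esub> \<or> y ! i = \<zero>\<^bsub>Fs ! i\<^esub>"
    if "i < length Fs" for i
    using domain.integral_iff[OF field.axioms(1)[OF field[OF that]]]
      RDirProd_list_carrier_mem(2) assms that by blast
  then show ?thesis
    using RDirProd_list_mult_nth[OF assms] RDirProd_list_zero_nth[of Fs]
    unfolding support_def list_eq_iff_nth_eq by auto
qed

text \<open>These idempotents realise every subset of \<open>I\<close> as a support; they provide
  annihilators and the vertices of the 5-cycle.\<close>

definition idem :: "nat set \<Rightarrow> 'a list" where
  "idem S = map (\<lambda>i. if i \<in> S then \<one>\<^bsub>Fs ! i\<^esub> else \<zero>\<^bsub>Fs ! i\<^esub>) [0..<length Fs]"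

lemma idem_carrier: "idem S \<in> carrier R"
proof (rule RDirProd_list_carrier_memI)
  fix i assume i: "i < length Fs"
  interpret field "Fs ! i" using field[OF i] .
  show "idem S ! i \<in> carrier (Fs ! i)" using i unfolding idem_def by simp
qed (simp add: idem_def)

lemma supp_idem:
  assumes "S \<subseteq> I"
  shows "supp (idem S) = S"
proof -
  have "\<one>\<^bsub>Fs ! i\<^esub> \<noteq> \<zero>\<^bsub>Fs ! i\<^esub>" if "i < length Fs" for i
    using domain.one_not_zero[OF field.axioms(1)[OF field[OF that]]] .
  then show ?thesis using assms unfolding support_def idem_def by (auto split: if_splits)
qed

text \<open>The support of a nonzero annihilating element must avoid \<open>supp x\<close>;
  conversely the idempotent on the complement of \<open>supp x\<close> annihilates
  \<open>x\<close>.\<close>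

lemma nonzero_zero_divisors_iff:
  "x \<in> nonzero_zero_divisors R \<longleftrightarrow> x \<in> carrier R \<and> supp x \<noteq> {} \<and> supp x \<noteq> I"
proof -
  have "(\<exists>y \<in> carrier R. y \<noteq> \<zero>\<^bsub>R\<^esub> \<and> x \<otimes>\<^bsub>R\<^esub> y = \<zero>\<^bsub>R\<^esub>) \<longleftrightarrow> supp x \<noteq> I"
    if x: "x \<in> carrier R"
  proof
    assume "\<exists>y \<in> carrier R. y \<noteq> \<zero>\<^bsub>R\<^esub> \<and> x \<otimes>\<^bsub>R\<^esub> y = \<zero>\<^bsub>R\<^esub>"
    then obtain y where "supp y \<noteq> {}" "supp x \<inter> supp y = {}"
      using eq_zero_iff mult_eq_zero_iff[OF x] by auto
    then show "supp x \<noteq> I" using supp_subset[of y] by auto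
  next
    assume ne: "supp x \<noteq> I"
    have "idem (I - supp x) \<noteq> \<zero>\<^bsub>R\<^esub>"
      using eq_zero_iff[OF idem_carrier] supp_idem[of "I - supp x"] ne supp_subset[of x] by auto
    moreover have "x \<otimes>\<^bsub>R\<^esub> idem (I - supp x) = \<zero>\<^bsub>R\<^esub>"
      using mult_eq_zero_iff[OF x idem_carrier] supp_idem[of "I - supp x"] by auto
    ultimately show "\<exists>y \<in> carrier R. y \<noteq> \<zero>\<^bsub>R\<^esub> \<and> x \<otimes>\<^bsub>R\<^esub> y = \<zero>\<^bsub>R\<^esub>"
      using idem_carrier by blast
  qed
  then show ?thesis
    unfolding nonzero_zero_divisors_def zero_divisors_def using eq_zero_iff by blast
qed

text \<open>Annihilators of \<open>x\<close> live off \<open>supp x\<close>, and \<open>r\<close>,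
  \<open>s\<close> with product zero have disjoint supports; points of these give \<open>i\<close>
  and \<open>j\<close>. Conversely the idempotents at \<open>i\<close> and \<open>j\<close> serve as
  \<open>r\<close> and \<open>s\<close>.\<close>

lemma weak_adjacent_iff:
  assumes x: "x \<in> carrier R" and y: "y \<in> carrier R"
  shows "(\<exists>r \<in> annihilator R x - {\<zero>\<^bsub>R\<^esub>}. \<exists>s \<in> annihilator R y - {\<zero>\<^bsub>R\<^esub>}. r \<otimes>\<^bsub>R\<^esub> s = \<zero>\<^bsub>R\<^esub>) \<longleftrightarrow>
    (\<exists>i \<in> I - supp x. \<exists>j \<in> I - supp y. i \<noteq> j)" (is "?L \<longleftrightarrow> ?R")
proof
  have ann: "r \<in> annihilator R z - {\<zero>\<^bsub>R\<^esub>} \<longleftrightarrow> r \<in> carrier R \<and> supp r \<noteq> {} \<and> supp r \<inter> supp z = {}"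
    if "z \<in> carrier R" for r z
    using eq_zero_iff mult_eq_zero_iff that unfolding annihilator_def by auto
  {
    assume ?L
    then obtain r s where rs: "r \<in> annihilator R x - {\<zero>\<^bsub>R\<^esub>}"
      "s \<in> annihilator R y - {\<zero>\<^bsub>R\<^esub>}" "r \<otimes>\<^bsub>R\<^esub> s = \<zero>\<^bsub>R\<^esub>" by blast
    then have r: "r \<in> carrier R" "supp r \<noteq> {}" "supp r \<inter> supp x = {}"
      and s: "s \<in> carrier R" "supp s \<noteq> {}" "supp s \<inter> supp y = {}"
      using ann x y by auto
    have "supp r \<inter> supp s = {}" using rs(3) mult_eq_zero_iff[OF r(1) s(1)] by simp
    moreover obtain i j where ij: "i \<in> supp r" "j \<in> supp s" using r(2) s(2) by blast
    ultimately have "i \<noteq> j" by blast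
    moreover have "i \<in> I - supp x" "j \<in> I - supp y"
      using ij r(3) s(3) supp_subset[of r] supp_subset[of s] by blast+
    ultimately show ?R by blast
  next
    assume ?R
    then obtain i j where ij: "i \<in> I - supp x" "j \<in> I - supp y" "i \<noteq> j" by blast
    then have "supp (idem {i}) = {i}" "supp (idem {j}) = {j}"
      using supp_idem[of "{i}"] supp_idem[of "{j}"] by auto
    then have "idem {i} \<in> annihilator R x - {\<zero>\<^bsub>R\<^esub>}" "idem {j} \<in> annihilator R y - {\<zero>\<^bsub>R\<^esub>}"
      "idem {i} \<otimes>\<^bsub>R\<^esub> idem {j} = \<zero>\<^bsub>R\<^esub>"
      using ij x y ann idem_carrier mult_eq_zero_iff[OF idem_carrier idem_carrier] by auto
    then show ?L by blast
  }
qed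

section \<open>Adjacency in the difference graph through supports\<close>

abbreviation "D \<equiv> weak_zero_divisor_difference_graph R"

text \<open>The complements of the supports are nonempty, and two nonempty sets admit no pair of
  distinct points, one from each, only if both are the same singleton. Removing the edges of the
  zero-divisor graph leaves the pairs with meeting supports.\<close>

lemma edge_iff:
  assumes "x \<in> nonzero_zero_divisors R" "y \<in> nonzero_zero_divisors R"
  shows "{x, y} \<in> edges D \<longleftrightarrow> x \<noteq> y \<and> supp x \<inter> supp y \<noteq> {} \<and>
    \<not> (supp x = supp y \<and> card (I - supp x) = 1)"
proof -
  \<comment> \<open>The relation given to \<open>graph_of_adj\<close> may be asymmetric while edges
    are unordered, so either order counts; \<open>sym\<close> merges the two orders for weak
    adjacency.\<close>
  have graph: "{x, y} \<in> edges (graph_of_adj V adj) \<longleftrightarrow> x \<in> V \<and> y \<in> V \<and> x \<noteq> y \<and> (adj x y \<or> adj y x)"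
    for V adj
    unfolding graph_of_adj_def by (auto simp: doubleton_eq_iff)
  have c: "x \<in> carrier R" "y \<in> carrier R" using assms nonzero_zero_divisors_iff by auto
  have "supp x \<noteq> I" "supp y \<noteq> I" using assms nonzero_zero_divisors_iff by auto
  then obtain a b where ab: "a \<in> I - supp x" "b \<in> I - supp y" using supp_subset by blast
  have weak: "(\<exists>i \<in> I - supp x. \<exists>j \<in> I - supp y. i \<noteq> j) \<longleftrightarrow>
    \<not> (supp x = supp y \<and> card (I - supp x) = 1)"
  proof
    assume *: "\<exists>i \<in> I - supp x. \<exists>j \<in> I - supp y. i \<noteq> j"
    show "\<not> (supp x = supp y \<and> card (I - supp x) = 1)"
    proof
      assume eq: "supp x = supp y \<and> card (I - supp x) = 1"
      then obtain k where "I - supp x = {k}" using card_1_singletonE by metis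
      then show False using * eq by auto
    qed
  next
    assume *: "\<not> (supp x = supp y \<and> card (I - supp x) = 1)"
    show "\<exists>i \<in> I - supp x. \<exists>j \<in> I - supp y. i \<noteq> j"
    proof (rule ccontr)
      assume "\<not> ?thesis"
      then have all: "i = j" if "i \<in> I - supp x" "j \<in> I - supp y" for i j
        using that by metis
      have "I - supp x = {b}" using all[OF _ ab(2)] ab(1) by auto
      moreover have "I - supp y = {b}" using all[OF ab(1)] ab(2) by auto
      moreover from calculation have "supp x = supp y"
        using supp_subset double_diff[OF _ subset_refl] by metis
      ultimately show False using * by simp
    qed
  qed
  have sym: "(\<exists>i \<in> A. \<exists>j \<in> B. i \<noteq> j) \<longleftrightarrow> (\<exists>i \<in> B. \<exists>j \<in> A. i \<noteq> j)" for A B :: "nat set"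
    by metis
  have "{x, y} \<in> edges D \<longleftrightarrow>
    {x, y} \<in> edges (weak_zero_divisor_graph R) \<and> {x, y} \<notin> edges (zero_divisor_graph R)"
    unfolding weak_zero_divisor_difference_graph_def delete_isolated_def by simp
  also have "{x, y} \<in> edges (weak_zero_divisor_graph R) \<longleftrightarrow>
    x \<noteq> y \<and> (\<exists>i \<in> I - supp x. \<exists>j \<in> I - supp y. i \<noteq> j)"
    unfolding weak_zero_divisor_graph_def graph weak_adjacent_iff[OF c]
      weak_adjacent_iff[OF c(2,1)] sym[of "I - supp y"] using assms by simp
  also have "{x, y} \<in> edges (zero_divisor_graph R) \<longleftrightarrow> x \<noteq> y \<and> supp x \<inter> supp y = {}"
    unfolding zero_divisor_graph_def graph mult_eq_zero_iff[OF c] mult_eq_zero_iff[OF c(2,1)]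
    using assms by (simp add: Int_commute)
  finally show ?thesis using weak by blast
qed

lemma verts_subset: "verts D \<subseteq> nonzero_zero_divisors R"
  unfolding weak_zero_divisor_difference_graph_def delete_isolated_def by auto

lemma verts_of_edge:
  assumes "x \<in> nonzero_zero_divisors R" "{x, y} \<in> edges D"
  shows "x \<in> verts D"
  using assms unfolding weak_zero_divisor_difference_graph_def delete_isolated_def by auto

section \<open>Perfection up to four factors and its failure from five on\<close>

lemma finite_carrier:
  assumes "\<And>i. i < length Fs \<Longrightarrow> finite (carrier (Fs ! i))"
  shows "finite (carrier R)"
proof (rule finite_subset)
  let ?U = "\<Union>i < length Fs. carrier (Fs ! i)"
  show "carrier R \<subseteq> {xs. set xs \<subseteq> ?U \<and> length xs = length Fs}"
    using RDirProd_list_carrier_mem[of _ Fs] by (fastforce simp: in_set_conv_nth)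
  show "finite {xs. set xs \<subseteq> ?U \<and> length xs = length Fs}"
    using assms by (intro finite_lists_length_eq) auto
qed

lemma perfect_if_at_most_four:
  assumes "\<And>i. i < length Fs \<Longrightarrow> finite (carrier (Fs ! i))" "length Fs \<le> 4"
  shows "perfect_graph D"
\<comment> \<open>The twin classes are the vertices sharing a coatom as support, so \<open>P\<close>
  says that exactly one point of \<open>I\<close> is missing.\<close>
proof (rule perfect_of_supports_in_four[of D I supp "\<lambda>A. card (I - A) = 1"])
  have "verts D \<subseteq> carrier R" using verts_subset nonzero_zero_divisors_iff by blast
  then show "finite (verts D)" using finite_carrier[OF assms(1)] finite_subset by blast
  show "supp v \<subseteq> I \<and> supp v \<noteq> {}" if "v \<in> verts D" for v
    using that verts_subset nonzero_zero_divisors_iff supp_subset by blast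
  show "{u, v} \<in> edges D \<longleftrightarrow> u \<noteq> v \<and> supp u \<inter> supp v \<noteq> {} \<and>
      \<not> (supp u = supp v \<and> card (I - supp u) = 1)" if "u \<in> verts D" "v \<in> verts D" for u v
    using that verts_subset edge_iff by blast
qed (use assms in auto)

lemma not_perfect_if_at_least_five:
  assumes "length Fs \<ge> 5"
  shows "\<not> perfect_graph D"
proof -
  let ?P = "{{0, 1}, {1, 2}, {2, 3}, {3, 4}, {4, 0}} :: nat set set"
  have sub: "S \<subseteq> {0..4}" if "S \<in> ?P" for S using that by auto
  have supp: "supp (idem S) = S" if "S \<in> ?P" for S
    using sub[OF that] assms by (intro supp_idem) auto
  have card2: "card S = 2" if "S \<in> ?P" for S using that by auto
  have nzd: "idem S \<in> nonzero_zero_divisors R" if "S \<in> ?P" for S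
  proof -
    have "S \<noteq> {}" "S \<noteq> I" using card2[OF that] assms by auto
    then show ?thesis using supp[OF that] idem_carrier nonzero_zero_divisors_iff by simp
  qed
  have edge: "{idem S, idem T} \<in> edges D \<longleftrightarrow> S \<noteq> T \<and> S \<inter> T \<noteq> {}" if "S \<in> ?P" "T \<in> ?P" for S T
  proof -
    have "idem S = idem T \<longleftrightarrow> S = T" using supp that by metis
    \<comment> \<open>A two-point set misses at least three points of \<open>I\<close>, so it is
      never a coatom and adjacency reduces to distinct sets that meet.\<close>
    moreover have "card (I - S) = length Fs - 2"
      using sub[OF that(1)] card2[OF that(1)] assms
      by (subst card_Diff_subset) (auto intro: finite_subset[of _ "{0..4}"])
    then have "card (I - S) \<noteq> 1" using assms by simp
    ultimately show ?thesis
      unfolding edge_iff[OF nzd[OF that(1)] nzd[OF that(2)]] supp[OF that(1)] supp[OF that(2)]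
      by blast
  qed
  have loopless: "{v} \<notin> edges D" if "v \<in> verts D" for v
    using edge_iff[of v v] that verts_subset by auto
  have cycle: "{idem {0, 1}, idem {1, 2}} \<in> edges D" "{idem {1, 2}, idem {2, 3}} \<in> edges D"
    "{idem {2, 3}, idem {3, 4}} \<in> edges D" "{idem {3, 4}, idem {4, 0}} \<in> edges D"
    "{idem {4, 0}, idem {0, 1}} \<in> edges D"
    by (simp_all add: edge doubleton_eq_iff)
  have chords: "{idem {0, 1}, idem {2, 3}} \<notin> edges D" "{idem {1, 2}, idem {3, 4}} \<notin> edges D"
    "{idem {2, 3}, idem {4, 0}} \<notin> edges D" "{idem {3, 4}, idem {0, 1}} \<notin> edges D"
    "{idem {4, 0}, idem {1, 2}} \<notin> edges D"
    by (simp_all add: edge doubleton_eq_iff)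
  have "{idem {0, 1}, idem {1, 2}, idem {2, 3}, idem {3, 4}, idem {4, 0}} \<subseteq> verts D"
    using verts_of_edge[OF nzd] cycle by blast
  from five_cycle_not_perfect[OF this cycle chords loopless] show ?thesis .
qed

end

theorem theorem5p3:
  fixes Fs :: "('a, 'm) ring_scheme list" and t :: nat
  assumes "length Fs = t"
    and "\<And>F. F \<in> set Fs \<Longrightarrow> field F \<and> finite (carrier F)"
  shows "(t \<in> {3, 4} \<longrightarrow>
            perfect_graph (weak_zero_divisor_difference_graph (RDirProd_list Fs))) \<and>
         (t \<ge> 5 \<longrightarrow>
            \<not> perfect_graph (weak_zero_divisor_difference_graph (RDirProd_list Fs)))"
proof -
  interpret field_list Fs
    by (rule field_list.intro) (simp add: assms(2))
  show ?thesis
    using perfect_if_at_most_four not_perfect_if_at_least_five assms by auto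
qed

end
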